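(* Assume ZFC together with Projective Determinacy. Let $(\mathfrak{K},\equiv,r)$ be a scattered projective ranked equivalence relation. Then there is an oracle $Y\in 2^\omega$ such that for every $Z\geq_T Y$ and every $X\in\mathfrak{K}$: if $r([X])<\omega_1^Z$, then $Z$ computes some member of the $\equiv$-equivalence class $[X]$.
   Context: A ranked equivalence relation consists of a set $\mathfrak{K}\subseteq 2^\omega$, an equivalence relation $\equiv$ on $\mathfrak{K}$, and a function $r\colon \mathfrak{K}/{\equiv}\to\omega_1$. It is projective if $\mathfrak{K}$ and $\equiv$ are projective sets and $r$ has a projective presentation, i.e., there is a projective function $g\colon 2^\omega\to 2^\omega$ such that for $X\in\mathfrak{K}$, $g(X)$ codes a well-ordering of order type $r([X])$. It is scattered if for each $\alpha<\omega_1$, $r^{-1}(\alpha)$ contains only countably many equivalence classes. $\omega_1^Z$ is the least ordinal with no $Z$-computable presentation. *)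

theory Defs
  imports "HOL-Analysis.Analysis"
begin

type_synonym cantor = "nat \<Rightarrow> bool"
type_synonym baire = "nat \<Rightarrow> nat"

section \<open>Projective sets and projective determinacy\<close>

text \<open>The topologies are the product topologies, with \<^typ>\<open>nat\<close> and \<^typ>\<open>bool\<close> discrete.
  The notions below are meant for Polish spaces; they are used for Baire space,
  Cantor space and the square of Cantor space.\<close>

definition join :: "baire \<Rightarrow> baire \<Rightarrow> baire" where
  "join y z = (\<lambda>n. if even n then y (n div 2) else z (n div 2))"

text \<open>\<open>Pi1 n\<close> is the boldface class \<open>\<Pi>\<^sup>1\<^bsub>n\<^esub>\<close> of subsets of \<open>X \<times> \<omega>\<^sup>\<omega>\<close>, where \<open>\<Pi>\<^sup>1\<^bsub>0\<^esub>\<close> stands for the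
  closed sets: a set is \<open>\<Pi>\<^sup>1\<^bsub>n+1\<^esub>\<close> iff its complement is the projection along \<open>\<omega>\<^sup>\<omega>\<close> of a \<open>\<Pi>\<^sup>1\<^bsub>n\<^esub>\<close> subset
  of \<open>X \<times> \<omega>\<^sup>\<omega> \<times> \<omega>\<^sup>\<omega>\<close>. The homeomorphism \<^const>\<open>join\<close> identifies \<open>\<omega>\<^sup>\<omega> \<times> \<omega>\<^sup>\<omega>\<close> with \<open>\<omega>\<^sup>\<omega>\<close>, which keeps
  the recursion within one type. The \<open>\<Sigma>\<^sup>1\<^bsub>n+1\<^esub>\<close> subsets of \<open>X\<close> are the projections of sets in \<open>Pi1 n\<close>.\<close>

primrec Pi1 :: "nat \<Rightarrow> ('a::topological_space \<times> baire) set set" where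
  "Pi1 0 = {C. closed C}"
| "Pi1 (Suc n) = {- {(x, y). \<exists>z. (x, join y z) \<in> C} | C. C \<in> Pi1 n}"

definition projective :: "'a::topological_space set \<Rightarrow> bool" where
  "projective A \<longleftrightarrow> (\<exists>n. \<exists>C \<in> Pi1 n. A = fst ` C)"

definition projective_fun :: "('a::topological_space \<Rightarrow> 'b::topological_space) \<Rightarrow> bool" where
  "projective_fun g \<longleftrightarrow> projective {(x, y). y = g x}"

text \<open>In the game on \<open>\<omega>\<close> with payoff set \<open>A\<close>, player I plays the even and player II the odd
  entries of \<open>x\<close>; player I wins iff \<open>x \<in> A\<close>. A strategy maps finite positions to moves.\<close>

definition winning_I :: "baire set \<Rightarrow> (nat list \<Rightarrow> nat) \<Rightarrow> bool" where
  "winning_I A \<sigma> \<longleftrightarrow> (\<forall>x. (\<forall>n. even n \<longrightarrow> x n = \<sigma> (map x [0..<n])) \<longrightarrow> x \<in> A)"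

definition winning_II :: "baire set \<Rightarrow> (nat list \<Rightarrow> nat) \<Rightarrow> bool" where
  "winning_II A \<tau> \<longleftrightarrow> (\<forall>x. (\<forall>n. odd n \<longrightarrow> x n = \<tau> (map x [0..<n])) \<longrightarrow> x \<notin> A)"

definition determined :: "baire set \<Rightarrow> bool" where
  "determined A \<longleftrightarrow> (\<exists>\<sigma>. winning_I A \<sigma>) \<or> (\<exists>\<tau>. winning_II A \<tau>)"

definition projective_determinacy :: bool where
  "projective_determinacy \<longleftrightarrow> (\<forall>A :: baire set. projective A \<longrightarrow> determined A)"

section \<open>Turing reducibility\<close>

text \<open>Partial recursive functions relative to an oracle. \<open>Evals Z f xs y\<close> means that the function
  denoted by \<open>f\<close> with oracle \<open>Z\<close> is defined at the arguments \<open>xs\<close> and has the value \<open>y\<close> there.\<close>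

datatype recfn =
    Zero
  | Succ
  | Proj nat
  | Oracle
  | Comp recfn "recfn list"
  | PrimRec recfn recfn
  | Mu recfn

inductive Evals :: "cantor \<Rightarrow> recfn \<Rightarrow> nat list \<Rightarrow> nat \<Rightarrow> bool" for Z :: cantor where
  Evals_Zero: "Evals Z Zero xs 0"
| Evals_Succ: "Evals Z Succ [x] (Suc x)"
| Evals_Proj: "i < length xs \<Longrightarrow> Evals Z (Proj i) xs (xs ! i)"
| Evals_Oracle: "Evals Z Oracle [x] (of_bool (Z x))"
| Evals_Comp: "length ys = length gs \<Longrightarrow> (\<forall>i < length gs. Evals Z (gs ! i) xs (ys ! i)) \<Longrightarrow>
    Evals Z f ys y \<Longrightarrow> Evals Z (Comp f gs) xs y"
| Evals_PrimRec_0: "Evals Z f xs y \<Longrightarrow> Evals Z (PrimRec f g) (0 # xs) y"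
| Evals_PrimRec_Suc: "Evals Z (PrimRec f g) (n # xs) y \<Longrightarrow> Evals Z g (n # y # xs) y' \<Longrightarrow>
    Evals Z (PrimRec f g) (Suc n # xs) y'"
| Evals_Mu: "Evals Z f (n # xs) 0 \<Longrightarrow> (\<forall>i < n. \<exists>y. Evals Z f (i # xs) (Suc y)) \<Longrightarrow>
    Evals Z (Mu f) xs n"

definition turing_le :: "cantor \<Rightarrow> cantor \<Rightarrow> bool" (infix \<open>\<le>\<^sub>T\<close> 50) where
  "X \<le>\<^sub>T Z \<longleftrightarrow> (\<exists>f. \<forall>n. Evals Z f [n] (of_bool (X n)))"

section \<open>Countable ordinals\<close>

text \<open>\<open>\<omega>\<^sub>1\<close> is the library's successor cardinal of \<open>\<aleph>\<^sub>0\<close>, a reflexive well-order. Its field is the set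
  of countable ordinals, \<open>\<alpha>\<close> being the order type of its set of strict predecessors.\<close>

definition omega1 :: "nat set rel" where
  "omega1 = cardSuc natLeq"

definition less_omega1 :: "nat set \<Rightarrow> nat set \<Rightarrow> bool" (infix \<open><\<^sub>\<Omega>\<close> 50) where
  "\<alpha> <\<^sub>\<Omega> \<beta> \<longleftrightarrow> \<alpha> \<in> underS omega1 \<beta>"

text \<open>A real codes a binary relation on \<open>\<omega>\<close>. Well-orders are reflexive, as in the library, so the
  domain (\<^const>\<open>Field\<close>) of the coded order may be any subset of \<open>\<omega>\<close>, finite or empty included.\<close>

definition coded_rel :: "cantor \<Rightarrow> nat rel" where
  "coded_rel X = {(m, n). X (prod_encode (m, n))}"

definition codes_ordinal :: "cantor \<Rightarrow> nat set \<Rightarrow> bool" where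
  "codes_ordinal X \<alpha> \<longleftrightarrow> \<alpha> \<in> Field omega1 \<and> (coded_rel X, Restr omega1 (underS omega1 \<alpha>)) \<in> ordIso"

text \<open>\<open>\<omega>\<^sub>1\<^sup>Z\<close>. A \<open>Z\<close>-computable presentation of an ordinal is a code of it computable from \<open>Z\<close>;
  there are only countably many of these, so the set below is nonempty.\<close>

definition omega1CK :: "cantor \<Rightarrow> nat set" where
  "omega1CK Z = wo_rel.minim omega1 {\<alpha> \<in> Field omega1. \<not> (\<exists>W. W \<le>\<^sub>T Z \<and> codes_ordinal W \<alpha>)}"

section \<open>Ranked equivalence relations\<close>

definition ranked_equiv :: "cantor set \<Rightarrow> cantor rel \<Rightarrow> (cantor set \<Rightarrow> nat set) \<Rightarrow> bool" where
  "ranked_equiv K E r \<longleftrightarrow> equiv K E \<and> r \<in> K // E \<rightarrow> Field omega1"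

definition projective_presentation ::
  "cantor set \<Rightarrow> cantor rel \<Rightarrow> (cantor set \<Rightarrow> nat set) \<Rightarrow> (cantor \<Rightarrow> cantor) \<Rightarrow> bool" where
  "projective_presentation K E r g \<longleftrightarrow>
     projective_fun g \<and> (\<forall>X \<in> K. codes_ordinal (g X) (r (E `` {X})))"

definition projective_ranked :: "cantor set \<Rightarrow> cantor rel \<Rightarrow> (cantor set \<Rightarrow> nat set) \<Rightarrow> bool" where
  "projective_ranked K E r \<longleftrightarrow>
     projective K \<and> projective E \<and> (\<exists>g. projective_presentation K E r g)"

definition scattered :: "cantor set \<Rightarrow> cantor rel \<Rightarrow> (cantor set \<Rightarrow> nat set) \<Rightarrow> bool" where
  "scattered K E r \<longleftrightarrow> (\<forall>\<alpha> \<in> Field omega1. countable {C \<in> K // E. r C = \<alpha>})"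

end

theory Submission
  imports Defs "HOL-Library.Countable_Set_Type"
begin

text \<open>Player I's moves \<open>x (2 * n) = Z n + 2 * W n\<close> are two reals \<open>Z\<close> and \<open>W\<close>, and player II's moves are a
  real \<open>y\<close>. Player I wins if \<open>y \<le>\<^sub>T Z\<close> and there is \<open>V \<in> K\<close> such that \<open>W\<close> and \<open>g V\<close> embed into each other and
  \<open>Z\<close> computes no member of \<open>[V]\<close>. The payoff set is projective, so the game is determined.

  If player I had a winning strategy, then \<open>W\<close> would be a continuous function of \<open>y\<close> with well-founded
  values, so the ranks \<open>r [V]\<close> that occur would be bounded by some \<open>\<beta> < \<omega>\<^sub>1\<close>. By scatteredness some \<open>y\<close>
  computes members of all classes of rank at most \<open>\<beta>\<close>, and playing it defeats the strategy.

  So player II has a winning strategy, and \<open>Y\<close> records its responses. If \<open>Z \<ge>\<^sub>T Y\<close> and \<open>r [X] < \<omega>\<^sub>1\<^sup>Z\<close>,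
  player I can play \<open>Z\<close> and a code \<open>W \<le>\<^sub>T Z\<close> of \<open>r [X]\<close>; the response is computable from \<open>Z\<close>, so player I can
  only lose because \<open>Z\<close> computes a member of \<open>[X]\<close>.\<close>

section \<open>Locally constant functions on Baire space\<close>

text \<open>Continuity into a discrete space, for any value type, so that lists and programs need no
  topology.\<close>

definition loc_const :: "(baire \<Rightarrow> 'a) \<Rightarrow> bool" where
  "loc_const f \<longleftrightarrow> (\<forall>x. \<exists>N. \<forall>x'. (\<forall>i<N. x' i = x i) \<longrightarrow> f x' = f x)"

lemma loc_constE:
  assumes "loc_const f"
  obtains N where "\<forall>x'. (\<forall>i<N. x' i = x i) \<longrightarrow> f x' = f x"
proof -
  have "\<exists>N. \<forall>x'. (\<forall>i<N. x' i = x i) \<longrightarrow> f x' = f x"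
    using assms by (simp only: loc_const_def)
  then show ?thesis by (elim exE) (rule that)
qed

lemma loc_const_const [intro, simp]: "loc_const (\<lambda>x. c)"
  by (simp add: loc_const_def)

lemma loc_const_coord [intro, simp]: "loc_const (\<lambda>x. x k)"
  unfolding loc_const_def by (metis lessI)

text \<open>Finitely many entries of \<open>x\<close> fix \<open>f x\<close>, and then finitely many
  more fix the result. This covers indices that are themselves read off from
  \<open>x\<close>.\<close>

lemma loc_const_bind:
  assumes f: "loc_const f" and g: "\<And>a. loc_const (g a)"
  shows "loc_const (\<lambda>x. g (f x) x)"
  unfolding loc_const_def
proof
  fix x
  obtain N where N: "\<forall>x'. (\<forall>i<N. x' i = x i) \<longrightarrow> f x' = f x"
    by (rule loc_constE[OF f])
  obtain M where M: "\<forall>x'. (\<forall>i<M. x' i = x i) \<longrightarrow> g (f x) x' = g (f x) x"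
    by (rule loc_constE[OF g])
  have "\<forall>x'. (\<forall>i<max N M. x' i = x i) \<longrightarrow> g (f x') x' = g (f x) x"
  proof (intro allI impI)
    fix x' assume x': "\<forall>i<max N M. x' i = x i"
    have "f x' = f x" by (rule N[rule_format]) (use x' in auto)
    moreover have "g (f x) x' = g (f x) x" by (rule M[rule_format]) (use x' in auto)
    ultimately show "g (f x') x' = g (f x) x" by (rule ssubst)
  qed
  then show "\<exists>N. \<forall>x'. (\<forall>i<N. x' i = x i) \<longrightarrow> g (f x') x' = g (f x) x" ..
qed

lemma loc_const_map: "loc_const f \<Longrightarrow> loc_const (\<lambda>x. F (f x))"
  by (rule loc_const_bind) auto

lemma loc_const_map2: "loc_const f \<Longrightarrow> loc_const g \<Longrightarrow> loc_const (\<lambda>x. F (f x) (g x))"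
  by (rule loc_const_bind[of f]) (auto intro: loc_const_map)

lemma loc_const_upto:
  assumes "\<And>i. loc_const (\<lambda>x. h x i)"
  shows "loc_const (\<lambda>x. map (h x) [0..<n])"
proof (induction n)
  case (Suc n)
  show ?case
    using loc_const_map2[OF Suc assms[of n], of "\<lambda>l a. l @ [a]"] by simp
qed simp

section \<open>Cylinders and the product topology\<close>

lemma open_if_cylinders:
  fixes S :: "(nat \<Rightarrow> 'b::discrete_topology) set"
  assumes "\<And>x. x \<in> S \<Longrightarrow> \<exists>N. \<forall>x'. (\<forall>i<N. x' i = x i) \<longrightarrow> x' \<in> S"
  shows "open S"
proof (subst open_subopen, intro ballI)
  fix x assume "x \<in> S"
  then obtain N where N: "\<forall>x'. (\<forall>i<N. x' i = x i) \<longrightarrow> x' \<in> S" using assms by blast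
  define T where "T = (\<Pi>\<^sub>E i\<in>UNIV. if i < N then {x i} else UNIV)"
  have "open T" unfolding T_def
    by (rule open_PiE) (auto simp: open_discrete intro: finite_subset[of _ "{..<N}"])
  moreover have "x \<in> T" by (auto simp: T_def PiE_def)
  moreover have "T \<subseteq> S"
  proof
    fix x' assume "x' \<in> T"
    then have "\<forall>i<N. x' i = x i" by (auto simp: T_def PiE_def Pi_def split: if_splits)
    then show "x' \<in> S" using N by blast
  qed
  ultimately show "\<exists>T. open T \<and> x \<in> T \<and> T \<subseteq> S" by blast
qed

lemma open_contains_cylinder:
  fixes S :: "(nat \<Rightarrow> 'b::topological_space) set"
  assumes "open S" "x \<in> S"
  shows "\<exists>N. \<forall>x'. (\<forall>i<N. x' i = x i) \<longrightarrow> x' \<in> S"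
proof -
  obtain X where X: "x \<in> (\<Pi>\<^sub>E i\<in>UNIV. X i)" "finite {i. X i \<noteq> UNIV}" "(\<Pi>\<^sub>E i\<in>UNIV. X i) \<subseteq> S"
    using product_topology_open_contains_basis[of "\<lambda>i. euclidean" UNIV S x] assms
    unfolding open_fun_def by auto
  obtain N where N: "\<forall>i\<in>{i. X i \<noteq> UNIV}. i < N"
    using X(2) finite_nat_set_iff_bounded by blast
  have "x' \<in> S" if "\<forall>i<N. x' i = x i" for x'
  proof -
    have "x' i \<in> X i" for i
      by (cases "X i = UNIV") (use that N X(1) in \<open>auto simp: PiE_def Pi_def\<close>)
    then show ?thesis using X(3) by auto
  qed
  then show ?thesis by blast
qed

lemma open_loc_const: "loc_const P \<Longrightarrow> open {x. P x}"
proof (rule open_if_cylinders)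
  fix x
  assume P: "loc_const P" and x: "x \<in> {x. P x}"
  obtain N where N: "\<forall>x'. (\<forall>i<N. x' i = x i) \<longrightarrow> P x' = P x"
    by (rule loc_constE[OF P])
  have "x' \<in> {x. P x}" if "\<forall>i<N. x' i = x i" for x'
    using N[rule_format, of x'] that x by simp
  then show "\<exists>N. \<forall>x'. (\<forall>i<N. x' i = x i) \<longrightarrow> x' \<in> {x. P x}" by blast
qed

lemma closed_loc_const: "loc_const P \<Longrightarrow> closed {x. P x}"
  using open_loc_const[OF loc_const_map[of P Not]] by (simp add: closed_def Collect_neg_eq)

lemma continuous_if_loc_const:
  fixes f :: "baire \<Rightarrow> nat \<Rightarrow> 'b::discrete_topology"
  assumes "\<And>i. loc_const (\<lambda>x. f x i)"
  shows "continuous_on UNIV f"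
proof (rule continuous_on_coordinatewise_then_product)
  fix i
  show "continuous_on UNIV (\<lambda>x. f x i)"
    unfolding continuous_on_open_vimage[OF open_UNIV]
    using open_loc_const[OF loc_const_map[OF assms], of "\<lambda>a. a \<in> _"] by (simp add: vimage_def)
qed

section \<open>Splitting a real into two halves, inverse to \<open>join\<close>\<close>

definition evens :: "baire \<Rightarrow> baire" where "evens w = (\<lambda>n. w (2 * n))"
definition odds :: "baire \<Rightarrow> baire" where "odds w = (\<lambda>n. w (Suc (2 * n)))"

lemma loc_const_evens:
  assumes "loc_const f"
  shows "loc_const (\<lambda>w. f (evens w))"
  unfolding loc_const_def
proof
  fix x
  obtain N where N: "\<forall>x'. (\<forall>i<N. x' i = evens x i) \<longrightarrow> f x' = f (evens x)"
    by (rule loc_constE[OF assms])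
  have "f (evens x') = f (evens x)" if "\<forall>i<2 * N. x' i = x i" for x'
    by (rule N[rule_format]) (use that in \<open>simp add: evens_def\<close>)
  then show "\<exists>N. \<forall>x'. (\<forall>i<N. x' i = x i) \<longrightarrow> f (evens x') = f (evens x)" by blast
qed

lemma evens_join [simp]: "evens (join y z) = y"
  and odds_join [simp]: "odds (join y z) = z"
  and join_evens_odds [simp]: "join (evens w) (odds w) = w"
  by (auto simp: evens_def odds_def join_def fun_eq_iff)

lemma continuous_on_coord:
  "continuous_on S f \<Longrightarrow> continuous_on S (\<lambda>x. f x k)"
  by (rule continuous_on_product_then_coordinatewise)

lemma continuous_on_evens [continuous_intros]:
  "continuous_on S f \<Longrightarrow> continuous_on S (\<lambda>x. evens (f x))"
  unfolding evens_def by (rule continuous_on_coordinatewise_then_product) (erule continuous_on_coord)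

lemma continuous_on_odds [continuous_intros]:
  "continuous_on S f \<Longrightarrow> continuous_on S (\<lambda>x. odds (f x))"
  unfolding odds_def by (rule continuous_on_coordinatewise_then_product) (erule continuous_on_coord)

lemma continuous_on_join [continuous_intros]:
  assumes "continuous_on S f" "continuous_on S g"
  shows "continuous_on S (\<lambda>x. join (f x) (g x))"
proof (rule continuous_on_coordinatewise_then_product)
  show "continuous_on S (\<lambda>x. join (f x) (g x) i)" for i
    using continuous_on_coord[OF assms(1), of "i div 2"] continuous_on_coord[OF assms(2), of "i div 2"]
    by (cases "even i") (simp_all add: join_def)
qed

section \<open>Closure properties of the projective sets\<close>

lemma Pi1_SucI:
  assumes "C \<in> Pi1 n" "\<And>x y. (x, y) \<in> D \<longleftrightarrow> \<not> (\<exists>z. (x, join y z) \<in> C)"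
  shows "D \<in> Pi1 (Suc n)"
proof -
  have "D = - {(x, y). \<exists>z. (x, join y z) \<in> C}" using assms(2) by (simp add: set_eq_iff)
  then show ?thesis using assms(1) unfolding Pi1.simps(2) by blast
qed

lemma Pi1_SucE:
  assumes "D \<in> Pi1 (Suc n)"
  obtains C where "C \<in> Pi1 n" "\<And>x y. (x, y) \<in> D \<longleftrightarrow> \<not> (\<exists>z. (x, join y z) \<in> C)"
proof -
  obtain C where C: "C \<in> Pi1 n" "D = - {(x, y). \<exists>z. (x, join y z) \<in> C}"
    using assms unfolding Pi1.simps(2) by blast
  show ?thesis by (rule that[OF C(1)]) (simp add: C(2))
qed

lemma projectiveI:
  assumes "C \<in> Pi1 n" "\<And>x. P x \<longleftrightarrow> (\<exists>z. (x, z) \<in> C)"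
  shows "projective {x. P x}"
proof -
  have "{x. P x} = fst ` C" by (force simp: assms(2))
  then show ?thesis unfolding projective_def using assms(1) by blast
qed

lemma projectiveE:
  assumes "projective {x. P x}"
  obtains n C where "C \<in> Pi1 n" "\<And>x. P x \<longleftrightarrow> (\<exists>z. (x, z) \<in> C)"
proof -
  obtain n C where C: "C \<in> Pi1 n" "{x. P x} = fst ` C"
    using assms unfolding projective_def by blast
  have "P x \<longleftrightarrow> x \<in> fst ` C" for x unfolding C(2)[symmetric] by simp
  then have "P x \<longleftrightarrow> (\<exists>z. (x, z) \<in> C)" for x by force
  then show ?thesis by (rule that[OF C(1)])
qed

text \<open>\<open>F\<close> is lifted to \<open>H\<close>, which sends \<open>(x, join y z)\<close>
  to \<open>F (x, y)\<close> with \<open>z\<close> joined to its second component. The induction is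
  applied to \<open>H\<close>, hence the generalization over \<open>F\<close>.\<close>

lemma Pi1_vimage:
  fixes F :: "'a::topological_space \<times> baire \<Rightarrow> 'b::topological_space \<times> baire"
  assumes "C \<in> Pi1 n" "continuous_on UNIV F"
  shows "F -` C \<in> Pi1 n"
  using assms
proof (induction n arbitrary: C F)
  case 0
  then show ?case by (simp add: closed_vimage)
next
  case (Suc n)
  obtain C0 where C0: "C0 \<in> Pi1 n" "\<And>x y. (x, y) \<in> C \<longleftrightarrow> \<not> (\<exists>z. (x, join y z) \<in> C0)"
    by (rule Pi1_SucE[OF Suc.prems(1)]) blast
  define H where "H = (\<lambda>p::'a \<times> baire. (fst (F (fst p, evens (snd p))),
    join (snd (F (fst p, evens (snd p)))) (odds (snd p))))"
  have "continuous_on UNIV (\<lambda>p::'a \<times> baire. F (fst p, evens (snd p)))"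
    by (intro continuous_on_compose2[OF Suc.prems(2)] continuous_intros) simp
  then have "continuous_on UNIV H"
    unfolding H_def by (intro continuous_intros)
  then have "H -` C0 \<in> Pi1 n" using Suc.IH C0(1) by blast
  then show ?case
  proof (rule Pi1_SucI)
    show "(x, y) \<in> F -` C \<longleftrightarrow> \<not> (\<exists>z. (x, join y z) \<in> H -` C0)" for x y
      by (cases "F (x, y)") (simp add: C0(2) H_def)
  qed
qed

text \<open>An open set is the union over \<open>N\<close> of the clopen sets of points whose cylinder of length \<open>N\<close>
  it contains; \<open>N\<close> becomes the first entry of the quantified real.\<close>

lemma closed_in_Pi1_1:
  fixes C :: "(baire \<times> baire) set"
  assumes "closed C"
  shows "C \<in> Pi1 (Suc 0)"
proof -
  define U where "U = (\<lambda>w. (evens w, odds w)) -` (- C)"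
  have "open U"
    unfolding U_def using assms by (intro open_vimage continuous_intros) auto
  \<comment> \<open>\<open>Q l\<close> says that the cylinder of \<open>l\<close> lies in
    \<open>U\<close>. For \<open>v = join x (join y z)\<close>, \<open>h v\<close> is
    \<open>join x y\<close> and the length \<open>N\<close> is \<open>z 0\<close>.\<close>
  define Q where "Q = (\<lambda>l. \<forall>w'. map w' [0..<length l] = l \<longrightarrow> w' \<in> U)"
  define h where "h = (\<lambda>v. join (evens v) (evens (odds v)))"
  define D where "D = {v. Q (map (h v) [0..<odds (odds v) 0])}"
  have "loc_const (\<lambda>v. h v i)" for i
    by (cases "even i") (simp_all add: h_def join_def evens_def odds_def)
  then have "loc_const (\<lambda>v. map (h v) [0..<n])" for n
    by (rule loc_const_upto)
  then have 1: "loc_const (\<lambda>v. Q (map (h v) [0..<n]))" for n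
    by (rule loc_const_map)
  have 2: "loc_const (\<lambda>v. odds (odds v) 0)" by (simp add: odds_def)
  have "loc_const (\<lambda>v. Q (map (h v) [0..<odds (odds v) 0]))"
    using loc_const_bind[OF 2, of "\<lambda>n v. Q (map (h v) [0..<n])"] 1 by simp
  then have "closed D" unfolding D_def by (rule closed_loc_const)
  then have "closed ((\<lambda>p. join (fst p) (snd p)) -` D)"
    by (intro closed_vimage continuous_intros)
  then have "(\<lambda>p. join (fst p) (snd p)) -` D \<in> Pi1 0" by simp
  then show ?thesis
  proof (rule Pi1_SucI)
    fix x y
    have "(x, y) \<notin> C \<longleftrightarrow> (\<exists>z. join x (join y z) \<in> D)"
    proof
      assume "(x, y) \<notin> C"
      then have "join x y \<in> U" by (simp add: U_def)
      then obtain N where "\<forall>w'. (\<forall>i<N. w' i = join x y i) \<longrightarrow> w' \<in> U"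
        using open_contains_cylinder[OF \<open>open U\<close>] by blast
      then have "join x (join y (\<lambda>_. N)) \<in> D"
        by (simp add: D_def Q_def h_def)
      then show "\<exists>z. join x (join y z) \<in> D" by blast
    next
      assume "\<exists>z. join x (join y z) \<in> D"
      then have "join x y \<in> U" by (auto simp: D_def Q_def h_def)
      then show "(x, y) \<notin> C" by (simp add: U_def)
    qed
    then show "(x, y) \<in> C \<longleftrightarrow> \<not> (\<exists>z. (x, join y z) \<in> (\<lambda>p. join (fst p) (snd p)) -` D)"
      by auto
  qed
qed

lemma Pi1_mono_Suc: "C \<in> Pi1 n \<Longrightarrow> C \<in> Pi1 (Suc n)" for C :: "(baire \<times> baire) set"
proof (induction n arbitrary: C)
  case 0
  then show ?case using closed_in_Pi1_1 by simp
next
  case (Suc n)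
  show ?case
    by (rule Pi1_SucE[OF Suc.prems]) (rule Pi1_SucI[OF Suc.IH])
qed

lemma Pi1_mono:
  fixes C :: "(baire \<times> baire) set"
  assumes "C \<in> Pi1 n" "n \<le> m"
  shows "C \<in> Pi1 m"
  using assms(2) by (induction m rule: dec_induct) (simp_all only: assms(1) Pi1_mono_Suc)

text \<open>Both closures are proved together because complementation swaps them: intersection at
  the next level uses union at this one, and conversely. For unions the two witnesses are stored in
  one real by \<open>join\<close>.\<close>

lemma Pi1_Int_Un:
  fixes C D :: "('a::topological_space \<times> baire) set"
  assumes "C \<in> Pi1 n" "D \<in> Pi1 n"
  shows "C \<inter> D \<in> Pi1 n \<and> C \<union> D \<in> Pi1 n"
  using assms
proof (induction n arbitrary: C D)
  case 0
  then show ?case by auto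
next
  case (Suc n)
  obtain C0 where C0: "C0 \<in> Pi1 n" "\<And>x y. (x, y) \<in> C \<longleftrightarrow> \<not> (\<exists>z. (x, join y z) \<in> C0)"
    by (rule Pi1_SucE[OF Suc.prems(1)]) blast
  obtain D0 where D0: "D0 \<in> Pi1 n" "\<And>x y. (x, y) \<in> D \<longleftrightarrow> \<not> (\<exists>z. (x, join y z) \<in> D0)"
    by (rule Pi1_SucE[OF Suc.prems(2)]) blast
  have "C0 \<union> D0 \<in> Pi1 n" using Suc.IH C0(1) D0(1) by blast
  then have "C \<inter> D \<in> Pi1 (Suc n)"
    by (rule Pi1_SucI) (simp add: C0(2) D0(2), blast)
  moreover
  define F where "F = (\<lambda>p::'a \<times> baire. (fst p, join (evens (snd p)) (evens (odds (snd p)))))"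
  define G where "G = (\<lambda>p::'a \<times> baire. (fst p, join (evens (snd p)) (odds (odds (snd p)))))"
  have "F -` C0 \<in> Pi1 n" "G -` D0 \<in> Pi1 n"
    unfolding F_def G_def by (intro Pi1_vimage C0(1) D0(1) continuous_intros)+
  then have "F -` C0 \<inter> G -` D0 \<in> Pi1 n" using Suc.IH by blast
  then have "C \<union> D \<in> Pi1 (Suc n)"
  proof (rule Pi1_SucI)
    fix x y
    have "(x, join y (join z z')) \<in> F -` C0 \<inter> G -` D0 \<longleftrightarrow> (x, join y z) \<in> C0 \<and> (x, join y z') \<in> D0"
      for z z' by (simp add: F_def G_def)
    then have "(\<exists>z. (x, join y z) \<in> F -` C0 \<inter> G -` D0) \<longleftrightarrow>
        (\<exists>z. (x, join y z) \<in> C0) \<and> (\<exists>z. (x, join y z) \<in> D0)"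
      by (metis join_evens_odds)
    then show "(x, y) \<in> C \<union> D \<longleftrightarrow> \<not> (\<exists>z. (x, join y z) \<in> F -` C0 \<inter> G -` D0)"
      by (simp add: C0(2) D0(2))
  qed
  ultimately show ?case by blast
qed

section \<open>Projective predicates under preimages, connectives and quantifiers\<close>

lemma projective_vimage:
  fixes f :: "'a::topological_space \<Rightarrow> 'b::topological_space"
  assumes "projective {x. P x}" "continuous_on UNIV f"
  shows "projective {x. P (f x)}"
proof -
  obtain n C where C: "C \<in> Pi1 n" "\<And>x. P x \<longleftrightarrow> (\<exists>z. (x, z) \<in> C)"
    by (rule projectiveE[OF assms(1)]) blast
  have "continuous_on UNIV (\<lambda>p::'a \<times> baire. f (fst p))"
    by (rule continuous_on_compose2[OF assms(2)]) (simp_all add: continuous_on_fst continuous_on_id)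
  then have "(\<lambda>p. (f (fst p), snd p)) -` C \<in> Pi1 n"
    by (intro Pi1_vimage[OF C(1)] continuous_intros)
  then show ?thesis by (rule projectiveI) (simp add: C(2))
qed

text \<open>The complement of a projection of a \<open>Pi1 n\<close> set, given a dummy second
  coordinate, is itself in \<open>Pi1 (Suc n)\<close>.\<close>

lemma projective_Not:
  assumes "projective {x. P x}"
  shows "projective {x. \<not> P (x :: 'a::topological_space)}"
proof -
  obtain n C where C: "C \<in> Pi1 n" "\<And>x. P x \<longleftrightarrow> (\<exists>z. (x, z) \<in> C)"
    by (rule projectiveE[OF assms]) blast
  have "(\<lambda>p::'a \<times> baire. (fst p, odds (snd p))) -` C \<in> Pi1 n"
    by (intro Pi1_vimage C(1) continuous_intros)
  then have "{p. \<not> P (fst p)} \<in> Pi1 (Suc n)"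
    by (rule Pi1_SucI) (simp add: C(2))
  then show ?thesis by (rule projectiveI) simp
qed

lemma projective_conj:
  fixes P Q :: "baire \<Rightarrow> bool"
  assumes "projective {x. P x}" "projective {x. Q x}"
  shows "projective {x. P x \<and> Q x}"
proof -
  obtain n C where C: "C \<in> Pi1 n" "\<And>x. P x \<longleftrightarrow> (\<exists>z. (x, z) \<in> C)"
    by (rule projectiveE[OF assms(1)]) blast
  obtain m D where D: "D \<in> Pi1 m" "\<And>x. Q x \<longleftrightarrow> (\<exists>z. (x, z) \<in> D)"
    by (rule projectiveE[OF assms(2)]) blast
  define F where "F = (\<lambda>p::baire \<times> baire. (fst p, evens (snd p)))"
  define G where "G = (\<lambda>p::baire \<times> baire. (fst p, odds (snd p)))"
  have "F -` C \<in> Pi1 (max n m)"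
    unfolding F_def by (intro Pi1_vimage Pi1_mono[OF C(1)] continuous_intros) simp
  moreover have "G -` D \<in> Pi1 (max n m)"
    unfolding G_def by (intro Pi1_vimage Pi1_mono[OF D(1)] continuous_intros) simp
  ultimately have "F -` C \<inter> G -` D \<in> Pi1 (max n m)" using Pi1_Int_Un by blast
  then show ?thesis
  proof (rule projectiveI)
    fix x
    have "(x, join z z') \<in> F -` C \<inter> G -` D \<longleftrightarrow> (x, z) \<in> C \<and> (x, z') \<in> D" for z z'
      by (simp add: F_def G_def)
    then show "P x \<and> Q x \<longleftrightarrow> (\<exists>z. (x, z) \<in> F -` C \<inter> G -` D)"
      unfolding C(2) D(2) by (metis join_evens_odds)
  qed
qed

text \<open>The witness \<open>y\<close> and the witness for \<open>P x y\<close> merge into one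
  real, so the level does not rise.\<close>

lemma projective_ex:
  fixes P :: "baire \<Rightarrow> baire \<Rightarrow> bool"
  assumes "projective {w. P (evens w) (odds w)}"
  shows "projective {x. \<exists>y. P x y}"
proof -
  obtain n C where C: "C \<in> Pi1 n" "\<And>w. P (evens w) (odds w) \<longleftrightarrow> (\<exists>z. (w, z) \<in> C)"
    by (rule projectiveE[OF assms]) blast
  define F where "F = (\<lambda>p::baire \<times> baire. (join (fst p) (evens (snd p)), odds (snd p)))"
  have "F -` C \<in> Pi1 n" unfolding F_def by (intro Pi1_vimage C(1) continuous_intros)
  then show ?thesis
  proof (rule projectiveI)
    fix x
    have "P x y \<longleftrightarrow> (\<exists>z. (join x y, z) \<in> C)" for y using C(2)[of "join x y"] by simp
    moreover have "(x, join y z) \<in> F -` C \<longleftrightarrow> (join x y, z) \<in> C" for y z by (simp add: F_def)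
    ultimately show "(\<exists>y. P x y) \<longleftrightarrow> (\<exists>z. (x, z) \<in> F -` C)"
      by (metis join_evens_odds)
  qed
qed

lemma projective_all:
  fixes P :: "baire \<Rightarrow> baire \<Rightarrow> bool"
  assumes "projective {w. P (evens w) (odds w)}"
  shows "projective {x. \<forall>y. P x y}"
  using projective_Not[OF projective_ex[of "\<lambda>x y. \<not> P x y", OF projective_Not[OF assms]]] by simp

lemma projective_closed:
  assumes "closed {x :: 'a::topological_space. P x}"
  shows "projective {x. P x}"
proof -
  have "fst -` {x. P x} \<in> (Pi1 0 :: ('a \<times> baire) set set)"
    using closed_vimage_fst[OF assms] by simp
  then show ?thesis by (rule projectiveI) simp
qed

lemma projective_open:
  assumes "open {x :: 'a::topological_space. P x}"
  shows "projective {x. P x}"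
proof -
  have "closed {x. \<not> P x}" using assms by (simp add: closed_def Collect_neg_eq)
  then show ?thesis using projective_Not[OF projective_closed[of "\<lambda>x. \<not> P x"]] by simp
qed

text \<open>Complexity is computed on Baire space; sets of reals in Cantor space enter through a
  continuous \<open>p\<close>.\<close>

lemma projective_mem:
  fixes p :: "baire \<Rightarrow> cantor"
  assumes "projective A" "\<And>i. loc_const (\<lambda>x. p x i)"
  shows "projective {x. p x \<in> A}"
  by (rule projective_vimage[of "\<lambda>x. x \<in> A"]) (simp_all add: assms continuous_if_loc_const)

lemma projective_mem2:
  fixes p q :: "baire \<Rightarrow> cantor"
  assumes "projective A" "\<And>i. loc_const (\<lambda>x. p x i)" "\<And>i. loc_const (\<lambda>x. q x i)"
  shows "projective {x. (p x, q x) \<in> A}"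
  by (rule projective_vimage[of "\<lambda>x. x \<in> A" "\<lambda>x. (p x, q x)"])
    (simp_all add: assms continuous_if_loc_const continuous_on_Pair)

section \<open>Computations\<close>

instance recfn :: countable
  by countable_datatype

section \<open>Programs for some arithmetic functions\<close>

lemma Evals_Comp1: "Evals Z g xs a \<Longrightarrow> Evals Z f [a] y \<Longrightarrow> Evals Z (Comp f [g]) xs y"
  using Evals_Comp[of "[a]" "[g]"] by simp

lemma Evals_Comp2:
  assumes "Evals Z g xs a" "Evals Z h xs b" "Evals Z f [a, b] y"
  shows "Evals Z (Comp f [g, h]) xs y"
  by (rule Evals_Comp[of "[a, b]"]) (use assms in \<open>auto simp: nth_Cons' less_Suc_eq\<close>)

primrec numeral_fn :: "nat \<Rightarrow> recfn" where
  "numeral_fn 0 = Zero"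
| "numeral_fn (Suc k) = Comp Succ [numeral_fn k]"

lemma Evals_numeral_fn: "Evals Z (numeral_fn k) xs k"
  by (induction k) (auto intro: Evals_Zero Evals_Comp1 Evals_Succ)

lemma Evals_Proj0: "Evals Z (Proj 0) (x # xs) x"
  using Evals_Proj[of 0 "x # xs"] by simp

lemma Evals_Proj1: "Evals Z (Proj 1) (w # x # xs) x"
  using Evals_Proj[of 1 "w # x # xs"] by simp

definition add_fn :: "recfn \<Rightarrow> recfn \<Rightarrow> recfn" where
  "add_fn f g = Comp (PrimRec (Proj 0) (Comp Succ [Proj 1])) [f, g]"

lemma Evals_add_fn:
  assumes "Evals Z f xs a" "Evals Z g xs b"
  shows "Evals Z (add_fn f g) xs (a + b)"
proof -
  have "Evals Z (PrimRec (Proj 0) (Comp Succ [Proj 1])) [n, b] (n + b)" for n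
  proof (induction n)
    case (Suc n)
    show ?case using Evals_PrimRec_Suc[OF Suc Evals_Comp1[OF Evals_Proj1 Evals_Succ]] by simp
  qed (auto intro: Evals_PrimRec_0 Evals_Proj0)
  then show ?thesis unfolding add_fn_def by (rule Evals_Comp2[OF assms])
qed

lemma Evals_linear: "\<exists>f. \<forall>Z n. Evals Z f [n] (a * n + b)"
proof (intro exI allI)
  fix Z n
  show "Evals Z (PrimRec (numeral_fn b) (add_fn (numeral_fn a) (Proj 1))) [n] (a * n + b)"
  proof (induction n)
    case 0
    show ?case using Evals_PrimRec_0[OF Evals_numeral_fn] by simp
  next
    case (Suc n)
    show ?case
      using Evals_PrimRec_Suc[OF Suc Evals_add_fn[OF Evals_numeral_fn[of _ a] Evals_Proj1]]
      by (simp add: add.assoc)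
  qed
qed

text \<open>Recovers one real from an oracle that stores countably many along arithmetic
  progressions.\<close>

lemma turing_le_linear:
  assumes "y \<le>\<^sub>T Z" "\<And>n. U n = y (a * n + b)"
  shows "U \<le>\<^sub>T Z"
proof -
  obtain f where f: "\<And>n. Evals Z f [n] (of_bool (y n))"
    using assms(1) unfolding turing_le_def by blast
  obtain l where l: "\<And>n. Evals Z l [n] (a * n + b)" using Evals_linear by blast
  have "Evals Z (Comp f [l]) [n] (of_bool (U n))" for n
    unfolding assms(2) by (rule Evals_Comp1[OF l f])
  then show ?thesis unfolding turing_le_def by blast
qed

text \<open>The leading digit 1 makes \<open>code4\<close> determine the number of base 4 digits as well.\<close>

primrec code4 :: "(nat \<Rightarrow> nat) \<Rightarrow> nat \<Rightarrow> nat" where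
  "code4 a 0 = 1"
| "code4 a (Suc n) = 4 * code4 a n + a n"

lemma code4_pos: "0 < code4 a n"
  by (induction n) auto

lemma code4_inject:
  assumes "code4 a n = code4 b m" "\<And>i. a i < 4" "\<And>i. b i < 4"
  shows "n = m \<and> (\<forall>i<n. a i = b i)"
  using assms(1)
proof (induction n arbitrary: m)
  case 0
  then show ?case
  proof (cases m)
    case (Suc k)
    then show ?thesis using 0 code4_pos[of b k] by simp
  qed simp
next
  case (Suc n)
  show ?case
  proof (cases m)
    case 0
    then show ?thesis using Suc.prems code4_pos[of a n] by simp
  next
    case (Suc k)
    then have eq: "4 * code4 a n + a n = 4 * code4 b k + b k" using Suc.prems by simp
    then have "code4 a n = code4 b k" "a n = b k" using assms(2)[of n] assms(3)[of k] by presburger+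
    then show ?thesis using Suc.IH[of k] Suc by (auto simp: less_Suc_eq)
  qed
qed

text \<open>The code of the first \<open>n + 1\<close> bits of \<open>Z\<close> and \<open>W\<close>
  arises by primitive recursion from the oracle and \<open>g\<close>; \<open>f\<close> then answers
  the query to \<open>Y\<close>. This is how \<open>Z\<close> computes the response of player
  II.\<close>

lemma Evals_code4:
  assumes "\<And>n. Evals Z f [n] (of_bool (Y n))"
    and "\<And>n. Evals Z g [n] (of_bool (W n))"
  shows "\<exists>h. \<forall>n. Evals Z h [n] (of_bool (Y (code4 (\<lambda>i. of_bool (Z i) + 2 * of_bool (W i)) (Suc n))))"
proof -
  define a where "a = (\<lambda>i. of_bool (Z i) + 2 * of_bool (W i) :: nat)"
  define digit where "digit = add_fn (Comp Oracle [Proj 0]) (add_fn (Comp g [Proj 0]) (Comp g [Proj 0]))"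
  define dbl where "dbl = add_fn (Proj 1) (Proj 1)"
  define c where "c = PrimRec (numeral_fn 1) (add_fn (add_fn dbl dbl) digit)"
  have digit: "Evals Z digit (n # xs) (of_bool (Z n) + (of_bool (W n) + of_bool (W n)))" for n xs
    unfolding digit_def
    by (intro Evals_add_fn Evals_Comp1[OF Evals_Proj0] Evals_Oracle assms)
  have c: "Evals Z c [n] (code4 a n)" for n
  proof (induction n)
    case 0
    show ?case unfolding c_def using Evals_PrimRec_0[OF Evals_numeral_fn[of Z 1]] by simp
  next
    case (Suc n)
    have "Evals Z (add_fn (add_fn dbl dbl) digit) [n, code4 a n]
      ((code4 a n + code4 a n) + (code4 a n + code4 a n) + (of_bool (Z n) + (of_bool (W n) + of_bool (W n))))"
      unfolding dbl_def by (intro Evals_add_fn Evals_Proj1 digit)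
    moreover have "(code4 a n + code4 a n) + (code4 a n + code4 a n)
      + (of_bool (Z n) + (of_bool (W n) + of_bool (W n))) = code4 a (Suc n)"
      by (simp add: a_def)
    ultimately have "Evals Z (add_fn (add_fn dbl dbl) digit) [n, code4 a n] (code4 a (Suc n))"
      by (simp only:)
    then show ?case using Suc unfolding c_def by (rule Evals_PrimRec_Suc[rotated])
  qed
  have "Evals Z (Comp f [Comp c [Succ]]) [n] (of_bool (Y (code4 a (Suc n))))" for n
    by (rule Evals_Comp1[OF Evals_Comp1[OF Evals_Succ c] assms(1)])
  then show ?thesis unfolding a_def by blast
qed

text \<open>The use principle: a derivation is finite, hence queries finitely many bits. A rule with
  several premises takes the maximum of their bounds.\<close>

lemma Evals_use:
  assumes "Evals Z f xs y"
  shows "\<exists>N. \<forall>Z'. (\<forall>i<N. Z' i = Z i) \<longrightarrow> Evals Z' f xs y"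
  using assms
proof induction
  case (Evals_Oracle x)
  have "Evals Z' Oracle [x] (of_bool (Z x))" if "\<forall>i<Suc x. Z' i = Z i" for Z'
    using Evals.Evals_Oracle[of Z' x] that by simp
  then show ?case by blast
next
  case (Evals_Comp ys gs xs f y)
  obtain M where M: "\<And>Z'. \<forall>i<M. Z' i = Z i \<Longrightarrow> Evals Z' f ys y" using Evals_Comp.IH by blast
  obtain N where N: "\<And>i Z'. i < length gs \<Longrightarrow> \<forall>j<N i. Z' j = Z j \<Longrightarrow> Evals Z' (gs ! i) xs (ys ! i)"
    using Evals_Comp.IH(1) by metis
  define K where "K = Max (insert M (N ` {..<length gs}))"
  have K: "M \<le> K" "i < length gs \<Longrightarrow> N i \<le> K" for i
    unfolding K_def by auto
  have "Evals Z' (Comp f gs) xs y" if "\<forall>i<K. Z' i = Z i" for Z'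
  proof (rule Evals.Evals_Comp[OF Evals_Comp.hyps(1)])
    show "\<forall>i<length gs. Evals Z' (gs ! i) xs (ys ! i)"
    proof (intro allI impI)
      fix i assume i: "i < length gs"
      show "Evals Z' (gs ! i) xs (ys ! i)"
        by (rule N[OF i]) (use that K(2)[OF i] in auto)
    qed
    show "Evals Z' f ys y" by (rule M) (use that K(1) in auto)
  qed
  then show ?case by blast
next
  case (Evals_PrimRec_Suc f g n xs y y')
  obtain M N where M: "\<And>Z'. \<forall>i<M. Z' i = Z i \<Longrightarrow> Evals Z' (PrimRec f g) (n # xs) y"
    and N: "\<And>Z'. \<forall>i<N. Z' i = Z i \<Longrightarrow> Evals Z' g (n # y # xs) y'"
    using Evals_PrimRec_Suc.IH by blast
  have "Evals Z' (PrimRec f g) (Suc n # xs) y'" if "\<forall>i<max M N. Z' i = Z i" for Z'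
    by (rule Evals.Evals_PrimRec_Suc[OF M N]) (use that in auto)
  then show ?case by blast
next
  case (Evals_Mu f n xs)
  obtain M where M: "\<And>Z'. \<forall>i<M. Z' i = Z i \<Longrightarrow> Evals Z' f (n # xs) 0" using Evals_Mu.IH by blast
  obtain N y where N: "\<And>i Z'. i < n \<Longrightarrow> \<forall>j<N i. Z' j = Z j \<Longrightarrow> Evals Z' f (i # xs) (Suc (y i))"
    using Evals_Mu.IH(2) by metis
  define K where "K = Max (insert M (N ` {..<n}))"
  have K: "M \<le> K" "i < n \<Longrightarrow> N i \<le> K" for i
    unfolding K_def by auto
  have "Evals Z' (Mu f) xs n" if "\<forall>i<K. Z' i = Z i" for Z'
  proof (rule Evals.Evals_Mu)
    show "\<forall>i<n. \<exists>y. Evals Z' f (i # xs) (Suc y)"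
    proof (intro allI impI)
      fix i assume i: "i < n"
      have "Evals Z' f (i # xs) (Suc (y i))"
        by (rule N[OF i]) (use that K(2)[OF i] in auto)
      then show "\<exists>y. Evals Z' f (i # xs) (Suc y)" ..
    qed
    show "Evals Z' f (n # xs) 0" by (rule M) (use that K(1) in auto)
  qed
  then show ?case by blast
qed (blast intro: Evals.intros)+

text \<open>For fixed program, input and output, the use principle gives an open set of oracles. The
  general set is a union of preimages of these, over the open sets on which program, input and
  output are constant.\<close>

lemma open_Evals:
  assumes q: "\<And>i. loc_const (\<lambda>x. q x i)"
    and "loc_const f" "loc_const xs" "loc_const y"
  shows "open {x. Evals (q x) (f x) (xs x) (y x)}"
proof -
  have "open {Z. Evals Z g l n}" for g l n
    by (rule open_if_cylinders) (use Evals_use in simp)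
  then have *: "open {x. Evals (q x) g l n}" for g l n
    using open_vimage[OF _ continuous_if_loc_const[of q, OF q], of "{Z. Evals Z g l n}"]
    by (simp add: vimage_def)
  have "loc_const (\<lambda>x. (f x, xs x, y x))"
    using assms(2-4) by (intro loc_const_map2[of _ _ Pair])
  then have "open {x. (f x, xs x, y x) = (g, l, n)}" for g l n
    by (intro open_loc_const, rule loc_const_map[where F = "\<lambda>t. t = (g, l, n)"])
  then have "open (\<Union>(g, l, n). {x. (f x, xs x, y x) = (g, l, n)} \<inter> {x. Evals (q x) g l n})"
    using * by (intro open_UN ballI) (auto intro!: open_Int)
  moreover have "(\<Union>(g, l, n). {x. (f x, xs x, y x) = (g, l, n)} \<inter> {x. Evals (q x) g l n})
      = {x. Evals (q x) (f x) (xs x) (y x)}" by auto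
  ultimately show ?thesis by simp
qed

text \<open>The quantifiers over programs, numbered by countability, and over arguments become
  quantifiers over reals of which only entry 0 is read. The matrix is open.\<close>

lemma projective_turing_le:
  fixes p q :: "baire \<Rightarrow> cantor"
  assumes p: "\<And>i. loc_const (\<lambda>x. p x i)" and q: "\<And>i. loc_const (\<lambda>x. q x i)"
  shows "projective {x. p x \<le>\<^sub>T q x}"
proof -
  \<comment> \<open>In the matrix \<open>w = join (join x e) n\<close>: \<open>x\<close> is
    \<open>evens (evens w)\<close>, \<open>e\<close> is \<open>odds (evens w)\<close> and
    \<open>n\<close> is \<open>odds w\<close>.\<close>
  have comp: "loc_const (\<lambda>w. f (evens (evens w)))" if "loc_const f" for f :: "baire \<Rightarrow> 'b"
    by (rule loc_const_evens[OF loc_const_evens[OF that]])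
  have e: "loc_const (\<lambda>w. from_nat (odds (evens w) 0) :: recfn)"
    by (rule loc_const_map) (simp add: odds_def evens_def)
  have n: "loc_const (\<lambda>w. odds w 0)" by (simp add: odds_def)
  then have n': "loc_const (\<lambda>w. [odds w 0])" by (rule loc_const_map)
  have "loc_const (\<lambda>w. p (evens (evens w)) (odds w 0))"
    using loc_const_bind[OF n, of "\<lambda>k w. p (evens (evens w)) k"] comp[OF p] by simp
  then have b: "loc_const (\<lambda>w. of_bool (p (evens (evens w)) (odds w 0)) :: nat)"
    by (rule loc_const_map)
  have "projective {w. Evals (q (evens (evens w))) (from_nat (odds (evens w) 0)) [odds w 0]
      (of_bool (p (evens (evens w)) (odds w 0)))}"
    by (rule projective_open, rule open_Evals) (rule comp[OF q] e n' b)+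
  then have "projective {w. \<forall>n::baire. Evals (q (evens w)) (from_nat (odds w 0)) [n 0]
      (of_bool (p (evens w) (n 0)))}"
    by (rule projective_all)
  then have "projective {x. \<exists>e::baire. \<forall>n::baire. Evals (q x) (from_nat (e 0)) [n 0]
      (of_bool (p x (n 0)))}"
    by (rule projective_ex)
  moreover have "(\<exists>e::baire. \<forall>n::baire. Evals (q x) (from_nat (e 0)) [n 0] (of_bool (p x (n 0))))
    \<longleftrightarrow> p x \<le>\<^sub>T q x" for x
  proof
    assume "\<exists>e::baire. \<forall>n::baire. Evals (q x) (from_nat (e 0)) [n 0] (of_bool (p x (n 0)))"
    then obtain e :: baire where e:
      "\<And>n::baire. Evals (q x) (from_nat (e 0)) [n 0] (of_bool (p x (n 0)))" by blast
    have "Evals (q x) (from_nat (e 0)) [n] (of_bool (p x n))" for n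
      using e[of "\<lambda>_. n"] by simp
    then show "p x \<le>\<^sub>T q x" unfolding turing_le_def by blast
  next
    assume "p x \<le>\<^sub>T q x"
    then obtain f where f: "\<And>n. Evals (q x) f [n] (of_bool (p x n))"
      unfolding turing_le_def by blast
    show "\<exists>e::baire. \<forall>n::baire. Evals (q x) (from_nat (e 0)) [n 0] (of_bool (p x (n 0)))"
      by (rule exI[of _ "\<lambda>_. to_nat f"]) (simp add: f)
  qed
  ultimately show ?thesis by simp
qed

section \<open>Strictly monotone maps between coded relations\<close>

text \<open>Maps in both directions replace isomorphism of codes. A map into a well-order makes
  \<open>R - Id\<close> well-founded, and \<open>f\<close> is itself a point of Baire space.\<close>

definition strict_map :: "nat rel \<Rightarrow> nat rel \<Rightarrow> bool" where
  "strict_map R S \<longleftrightarrow> (\<exists>f. \<forall>m n. (m, n) \<in> R \<and> m \<noteq> n \<longrightarrow> (f m, f n) \<in> S \<and> f m \<noteq> f n)"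

text \<open>For fixed \<open>m\<close> and \<open>n\<close> the condition on \<open>f\<close> is
  locally constant, hence closed. The intersection over \<open>m\<close> and \<open>n\<close> is
  closed, and \<open>f\<close> is projected away.\<close>

lemma projective_strict_map:
  fixes p q :: "baire \<Rightarrow> cantor"
  assumes p: "\<And>i. loc_const (\<lambda>x. p x i)" and q: "\<And>i. loc_const (\<lambda>x. q x i)"
  shows "projective {x. strict_map (coded_rel (p x)) (coded_rel (q x))}"
proof -
  have "loc_const (\<lambda>w. (odds w m, odds w n))" for m n
    by (rule loc_const_map2) (simp_all add: odds_def)
  then have "loc_const (\<lambda>w. q (evens w) (prod_encode (odds w m, odds w n)))" for m n
    using loc_const_bind[of "\<lambda>w. (odds w m, odds w n)" "\<lambda>k w. q (evens w) (prod_encode k)"]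
      loc_const_evens[OF q] by simp
  moreover have "loc_const (\<lambda>w. odds w m \<noteq> odds w n)" for m n
    by (rule loc_const_map2) (simp_all add: odds_def)
  ultimately have "loc_const (\<lambda>w. q (evens w) (prod_encode (odds w m, odds w n)) \<and> odds w m \<noteq> odds w n)"
    for m n by (rule loc_const_map2)
  then have "loc_const (\<lambda>w. p (evens w) (prod_encode (m, n)) \<and> m \<noteq> n \<longrightarrow>
      q (evens w) (prod_encode (odds w m, odds w n)) \<and> odds w m \<noteq> odds w n)" for m n
    by (rule loc_const_map2[where F = "\<lambda>a b. a \<and> m \<noteq> n \<longrightarrow> b", OF loc_const_evens[OF p]])
  then have "closed {w. p (evens w) (prod_encode (m, n)) \<and> m \<noteq> n \<longrightarrow>
      q (evens w) (prod_encode (odds w m, odds w n)) \<and> odds w m \<noteq> odds w n}" for m n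
    by (rule closed_loc_const)
  then have "closed {w. \<forall>m n. p (evens w) (prod_encode (m, n)) \<and> m \<noteq> n \<longrightarrow>
      q (evens w) (prod_encode (odds w m, odds w n)) \<and> odds w m \<noteq> odds w n}"
    by (intro closed_Collect_all)
  then show ?thesis
    unfolding strict_map_def coded_rel_def mem_Collect_eq case_prod_conv
    by (intro projective_ex projective_closed)
qed

section \<open>Countable ordinals\<close>

lemma Card_order_omega1: "Card_order omega1"
  unfolding omega1_def by (rule cardSuc_Card_order[OF natLeq_Card_order])

lemma Well_order_omega1: "Well_order omega1"
  using Card_order_omega1 unfolding card_order_on_def by blast

lemma less_omega1_iff: "\<alpha> <\<^sub>\<Omega> \<beta> \<longleftrightarrow> (\<alpha>, \<beta>) \<in> omega1 \<and> \<alpha> \<noteq> \<beta>"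
  unfolding less_omega1_def underS_def by blast

lemma less_omega1_trans: "\<alpha> <\<^sub>\<Omega> \<beta> \<Longrightarrow> \<beta> <\<^sub>\<Omega> \<gamma> \<Longrightarrow> \<alpha> <\<^sub>\<Omega> \<gamma>"
  using Well_order_omega1
  unfolding less_omega1_iff order_on_defs by (metis antisymD transD)

lemma less_omega1_linear:
  "\<alpha> \<in> Field omega1 \<Longrightarrow> \<beta> \<in> Field omega1 \<Longrightarrow> \<alpha> <\<^sub>\<Omega> \<beta> \<or> \<alpha> = \<beta> \<or> \<beta> <\<^sub>\<Omega> \<alpha>"
  using Well_order_omega1 unfolding less_omega1_iff order_on_defs total_on_def by blast

lemma less_omega1_Field: "\<alpha> <\<^sub>\<Omega> \<beta> \<Longrightarrow> \<alpha> \<in> Field omega1 \<and> \<beta> \<in> Field omega1"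
  unfolding less_omega1_iff Field_def by blast

lemma wf_less_omega1: "wf {(\<alpha>, \<beta>). \<alpha> <\<^sub>\<Omega> \<beta>}"
proof -
  have "{(\<alpha>, \<beta>). \<alpha> <\<^sub>\<Omega> \<beta>} = omega1 - Id" unfolding less_omega1_iff by auto
  then show ?thesis using Well_order_omega1 unfolding well_order_on_def by simp
qed

lemma less_omega1_irrefl: "\<not> \<alpha> <\<^sub>\<Omega> \<alpha>"
  unfolding less_omega1_iff by simp

lemma countable_underS_omega1: "\<alpha> \<in> Field omega1 \<Longrightarrow> countable (underS omega1 \<alpha>)"
  using card_of_underS[OF Card_order_omega1]
  unfolding countable_card_le_natLeq omega1_def
  by (simp add: cardSuc_ordLeq_ordLess natLeq_Card_order card_of_Card_order)

lemma uncountable_Field_omega1: "\<not> countable (Field omega1)"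
proof
  assume "countable (Field omega1)"
  then have "(omega1, natLeq) \<in> ordLeq"
    using card_of_Field_ordIso[OF Card_order_omega1] ordIso_ordLeq_trans ordIso_symmetric
    unfolding countable_card_le_natLeq by blast
  moreover have "(natLeq, omega1) \<in> ordLess"
    unfolding omega1_def by (rule cardSuc_greater[OF natLeq_Card_order])
  ultimately show False using not_ordLess_ordLeq by blast
qed

text \<open>Countably many countable initial segments, endpoints included, do not exhaust the
  uncountable field; any ordinal outside them lies above all of \<open>D\<close>.\<close>

lemma countable_bounded_omega1:
  assumes "countable D" "D \<subseteq> Field omega1"
  shows "\<exists>\<beta>\<in>Field omega1. \<forall>\<alpha>\<in>D. \<alpha> <\<^sub>\<Omega> \<beta>"
proof -
  have "countable (\<Union>\<alpha>\<in>D. insert \<alpha> (underS omega1 \<alpha>))"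
    using assms countable_underS_omega1 by (intro countable_UN) auto
  then have "\<not> Field omega1 \<subseteq> (\<Union>\<alpha>\<in>D. insert \<alpha> (underS omega1 \<alpha>))"
    using uncountable_Field_omega1 countable_subset by blast
  then obtain \<beta> where \<beta>: "\<beta> \<in> Field omega1" "\<forall>\<alpha>\<in>D. \<beta> \<noteq> \<alpha> \<and> \<not> \<beta> <\<^sub>\<Omega> \<alpha>"
    unfolding less_omega1_def by blast
  then have "\<forall>\<alpha>\<in>D. \<alpha> <\<^sub>\<Omega> \<beta>" using less_omega1_linear assms(2) by blast
  then show ?thesis using \<beta>(1) by blast
qed

text \<open>Well-founded recursion: as the type is countable, the ranks of the predecessors of
  \<open>a\<close> have a strict bound in \<omega>1. Any such bound is chosen, not the least
  one.\<close>

lemma omega1_rank_exists: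
  fixes R :: "'a::countable rel"
  assumes "wf R"
  shows "\<exists>\<phi>. \<forall>a. \<phi> a \<in> Field omega1 \<and> (\<forall>b. (b, a) \<in> R \<longrightarrow> \<phi> b <\<^sub>\<Omega> \<phi> a)"
proof -
  define F where "F = (\<lambda>f a. SOME \<gamma>. \<gamma> \<in> Field omega1 \<and> (\<forall>b. (b, a) \<in> R \<longrightarrow> f b <\<^sub>\<Omega> \<gamma>))"
  define \<phi> where "\<phi> = wfrec R F"
  have "\<phi> a \<in> Field omega1 \<and> (\<forall>b. (b, a) \<in> R \<longrightarrow> \<phi> b <\<^sub>\<Omega> \<phi> a)" for a
    using assms
  proof (induction a rule: wf_induct_rule)
    case (less a)
    have "\<phi> a = F (cut \<phi> R a) a" unfolding \<phi>_def by (rule wfrec[OF assms])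
    also have "\<dots> = F \<phi> a" unfolding F_def by (simp add: cut_apply cong: conj_cong)
    finally have eq: "\<phi> a = F \<phi> a" .
    obtain \<gamma> where "\<gamma> \<in> Field omega1" "\<forall>\<delta>\<in>\<phi> ` {b. (b, a) \<in> R}. \<delta> <\<^sub>\<Omega> \<gamma>"
      using countable_bounded_omega1[of "\<phi> ` {b. (b, a) \<in> R}"] less by blast
    then have "\<gamma> \<in> Field omega1 \<and> (\<forall>b. (b, a) \<in> R \<longrightarrow> \<phi> b <\<^sub>\<Omega> \<gamma>)" by blast
    then show ?case unfolding eq F_def by (rule someI)
  qed
  then show ?thesis by blast
qed

text \<open>A form of \<open>\<Sigma>\<^sup>1\<^bsub>1\<^esub>\<close>-boundedness. The relation \<open>R\<close> is well-founded since the finite sequences in a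
  descending chain union to a real \<open>y\<close> with \<open>S y\<close> ill-founded; a rank function for \<open>R\<close> on the initial
  segments of \<open>y\<close> ranks every \<open>S y\<close>.\<close>

lemma continuous_family_bounded:
  fixes S :: "baire \<Rightarrow> nat rel"
  assumes loc: "\<And>m n. loc_const (\<lambda>y. (m, n) \<in> S y)" and wf: "\<And>y. wf (S y)"
  shows "\<exists>\<beta>\<in>Field omega1. \<forall>y. \<exists>h. (\<forall>n. h n <\<^sub>\<Omega> \<beta>) \<and> (\<forall>m n. (m, n) \<in> S y \<longrightarrow> h m <\<^sub>\<Omega> h n)"
proof -
  \<comment> \<open>The last condition says that \<open>u'\<close> forces \<open>(m, n)\<close> into
    \<open>S\<close>, since it concerns every real extending \<open>u'\<close>.\<close>
  define R :: "(nat list \<times> nat) rel" where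
    "R = {((u', m), (u, n)). length u < length u' \<and> (\<forall>i<length u. u' ! i = u ! i) \<and>
      (\<forall>y. (\<forall>i<length u'. y i = u' ! i) \<longrightarrow> (m, n) \<in> S y)}"
  have "wf R"
    unfolding wf_iff_no_infinite_down_chain
  proof
    assume "\<exists>f. \<forall>i. (f (Suc i), f i) \<in> R"
    then obtain f where f: "\<And>i. (f (Suc i), f i) \<in> R" by blast
    define u where "u = (\<lambda>i. fst (f i))"
    define n where "n = (\<lambda>i. snd (f i))"
    have uR: "((u (Suc i), n (Suc i)), (u i, n i)) \<in> R" for i
      using f[of i] by (simp add: u_def n_def)
    have len: "length (u i) < length (u (Suc i))"
      and ext: "\<And>j. j < length (u i) \<Longrightarrow> u (Suc i) ! j = u i ! j"
      and S: "\<And>y. (\<forall>j<length (u (Suc i)). y j = u (Suc i) ! j) \<Longrightarrow> (n (Suc i), n i) \<in> S y" for i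
      using uR[of i] unfolding R_def by auto
    have len_ge: "i \<le> length (u i)" for i
      by (induction i) (use len Suc_leI le_less_trans in blast)+
    have mono: "length (u i) \<le> length (u k) \<and> (\<forall>j<length (u i). u k ! j = u i ! j)" if "i \<le> k" for i k
      using that
    proof (induction k rule: dec_induct)
      case (step k)
      then show ?case using len[of k] ext[of _ k] by auto
    qed simp
    \<comment> \<open>Entry \<open>j\<close> is read from \<open>u (Suc j)\<close>, which is longer
      than \<open>j\<close> by \<open>len_ge\<close>.\<close>
    define y where "y = (\<lambda>j. u (Suc j) ! j)"
    have y: "y j = u k ! j" if "j < length (u k)" for j k
    proof (cases "k \<le> Suc j")
      case True
      then show ?thesis using mono[OF True] that by (simp add: y_def)
    next
      case False
      then show ?thesis using mono[of "Suc j" k] len_ge[of "Suc j"] by (simp add: y_def)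
    qed
    have "(n (Suc i), n i) \<in> S y" for i by (rule S) (simp add: y)
    then show False using wf[of y] unfolding wf_iff_no_infinite_down_chain by blast
  qed
  from omega1_rank_exists[OF this] obtain \<phi> where
    "\<forall>a. \<phi> a \<in> Field omega1 \<and> (\<forall>b. (b, a) \<in> R \<longrightarrow> \<phi> b <\<^sub>\<Omega> \<phi> a)" ..
  then have \<phi>: "\<And>a. \<phi> a \<in> Field omega1" "\<And>a b. (b, a) \<in> R \<Longrightarrow> \<phi> b <\<^sub>\<Omega> \<phi> a"
    by blast+
  have "\<exists>\<beta>\<in>Field omega1. \<forall>\<alpha>\<in>range \<phi>. \<alpha> <\<^sub>\<Omega> \<beta>"
    by (intro countable_bounded_omega1 image_subsetI \<phi>(1)) simp
  then obtain \<beta> where \<beta>: "\<beta> \<in> Field omega1" "\<forall>\<alpha>\<in>range \<phi>. \<alpha> <\<^sub>\<Omega> \<beta>" ..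
  have \<phi>_less: "\<phi> a <\<^sub>\<Omega> \<beta>" for a
    using \<beta>(2) by (rule bspec) (rule rangeI)
  have "\<exists>h. (\<forall>n. h n <\<^sub>\<Omega> \<beta>) \<and> (\<forall>m n. (m, n) \<in> S y \<longrightarrow> h m <\<^sub>\<Omega> h n)" for y
  proof -
    \<comment> \<open>\<open>\<psi> n k\<close> ranks the node of \<open>n\<close> and the first
      \<open>k\<close> entries of \<open>y\<close>. The rank of \<open>n\<close> must not depend on
      \<open>k\<close>, so the least value is used, attained at \<open>\<kappa> n\<close>.\<close>
    define \<psi> where "\<psi> = (\<lambda>n k. \<phi> (map y [0..<k], n))"
    have "\<exists>k. \<forall>k'. \<not> \<psi> n k' <\<^sub>\<Omega> \<psi> n k" for n
      using wf_less_omega1[unfolded wf_eq_minimal, rule_format, of "\<psi> n 0" "range (\<psi> n)"] by auto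
    then obtain \<kappa> where \<kappa>: "\<And>n k'. \<not> \<psi> n k' <\<^sub>\<Omega> \<psi> n (\<kappa> n)" by metis
    have "\<psi> m (\<kappa> m) <\<^sub>\<Omega> \<psi> n (\<kappa> n)" if "(m, n) \<in> S y" for m n
    proof -
      obtain N where "\<forall>y'. (\<forall>i<N. y' i = y i) \<longrightarrow> ((m, n) \<in> S y') = ((m, n) \<in> S y)"
        by (rule loc_constE[OF loc])
      then have N: "(m, n) \<in> S y'" if "\<forall>i<N. y' i = y i" for y'
        using that \<open>(m, n) \<in> S y\<close> by simp
      \<comment> \<open>The first \<open>N\<close> entries force \<open>(m, n)\<close> into
        \<open>S y\<close>; \<open>Suc (\<kappa> n)\<close> makes the extension proper.\<close>
      define k where "k = max N (Suc (\<kappa> n))"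
      have "(m, n) \<in> S y'" if "\<forall>i<k. y' i = map y [0..<k] ! i" for y'
        by (rule N) (use that in \<open>simp add: k_def\<close>)
      then have "((map y [0..<k], m), (map y [0..<\<kappa> n], n)) \<in> R"
        unfolding R_def by (simp add: k_def)
      then have "\<psi> m k <\<^sub>\<Omega> \<psi> n (\<kappa> n)" unfolding \<psi>_def by (rule \<phi>(2))
      moreover have "\<psi> m (\<kappa> m) <\<^sub>\<Omega> \<psi> m k \<or> \<psi> m (\<kappa> m) = \<psi> m k"
        using less_omega1_linear \<kappa>[of m k] \<phi>(1) unfolding \<psi>_def by blast
      ultimately show ?thesis using less_omega1_trans by metis
    qed
    moreover have "\<psi> n (\<kappa> n) <\<^sub>\<Omega> \<beta>" for n unfolding \<psi>_def by (rule \<phi>_less)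
    ultimately show ?thesis by (intro exI[of _ "\<lambda>n. \<psi> n (\<kappa> n)"]) simp
  qed
  then show ?thesis using \<beta>(1) by blast
qed

text \<open>\<open>h\<close> after the isomorphism is a strictly increasing map from \<alpha> into
  \<beta>. Such a map sends no ordinal below itself, since the image of a least such ordinal would
  be a smaller one; but if \<beta> were below \<alpha>, it would send \<beta> below itself.\<close>

lemma codes_ordinal_le:
  assumes codes: "codes_ordinal X \<alpha>" and "\<And>n. h n <\<^sub>\<Omega> \<beta>"
    and h: "\<And>m n. (m, n) \<in> coded_rel X \<Longrightarrow> m \<noteq> n \<Longrightarrow> h m <\<^sub>\<Omega> h n"
  shows "\<not> \<beta> <\<^sub>\<Omega> \<alpha>"
proof
  assume \<beta>: "\<beta> <\<^sub>\<Omega> \<alpha>"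
  let ?r = "Restr omega1 (underS omega1 \<alpha>)"
  have "(?r, coded_rel X) \<in> ordIso"
    using codes ordIso_symmetric unfolding codes_ordinal_def by blast
  then obtain e where e: "iso ?r (coded_rel X) e" unfolding ordIso_def by blast
  have lt: "h (e \<gamma>) <\<^sub>\<Omega> h (e \<delta>)" if "\<gamma> <\<^sub>\<Omega> \<delta>" "\<delta> <\<^sub>\<Omega> \<alpha>" for \<gamma> \<delta>
  proof -
    have "\<gamma> <\<^sub>\<Omega> \<alpha>" using that less_omega1_trans by blast
    then have r: "(\<gamma>, \<delta>) \<in> ?r" "\<gamma> \<noteq> \<delta>"
      using that unfolding less_omega1_iff by (auto simp: underS_def)
    then have "\<gamma> \<in> Field ?r" "\<delta> \<in> Field ?r" unfolding Field_def by blast+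
    then have "(e \<gamma>, e \<delta>) \<in> coded_rel X" "e \<gamma> \<noteq> e \<delta>"
      using e r unfolding iso_iff2 bij_betw_def inj_on_def by blast+
    then show ?thesis by (rule h)
  qed
  have "\<gamma> <\<^sub>\<Omega> \<alpha> \<longrightarrow> \<not> h (e \<gamma>) <\<^sub>\<Omega> \<gamma>" for \<gamma>
    using wf_less_omega1
  proof (induction \<gamma> rule: wf_induct_rule)
    case (less \<gamma>)
    then show ?case using lt less_omega1_trans by blast
  qed
  then show False using \<beta> assms(2) by blast
qed

lemma strict_map_if_codes_ordinal:
  assumes "codes_ordinal V \<alpha>" "codes_ordinal W \<alpha>"
  shows "strict_map (coded_rel V) (coded_rel W)"
proof -
  have "(coded_rel V, coded_rel W) \<in> ordIso"
    using assms ordIso_symmetric ordIso_transitive unfolding codes_ordinal_def by blast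
  then obtain f where f: "iso (coded_rel V) (coded_rel W) f" unfolding ordIso_def by blast
  have "(f m, f n) \<in> coded_rel W \<and> f m \<noteq> f n" if "(m, n) \<in> coded_rel V" "m \<noteq> n" for m n
  proof -
    have "m \<in> Field (coded_rel V)" "n \<in> Field (coded_rel V)" using that unfolding Field_def by blast+
    then show ?thesis using f that unfolding iso_iff2 bij_betw_def inj_on_def by blast
  qed
  then show ?thesis unfolding strict_map_def by blast
qed

lemma wf_if_strict_map:
  assumes "strict_map R (coded_rel V)" "codes_ordinal V \<alpha>"
  shows "wf (R - Id)"
proof -
  obtain f where f: "\<And>m n. (m, n) \<in> R \<Longrightarrow> m \<noteq> n \<Longrightarrow> (f m, f n) \<in> coded_rel V \<and> f m \<noteq> f n"
    using assms(1) unfolding strict_map_def by blast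
  have "wf (coded_rel V - Id)"
    using assms(2) unfolding codes_ordinal_def ordIso_def well_order_on_def by blast
  then have "wf (inv_image (coded_rel V - Id) f)" by (rule wf_inv_image)
  then show ?thesis by (rule wf_subset) (use f in \<open>auto simp: inv_image_def\<close>)
qed

text \<open>An ordinal without a \<open>Z\<close>-computable code belongs to the set whose minimum
  is \<open>omega1CK Z\<close>.\<close>

lemma code_below_omega1CK:
  assumes "\<alpha> <\<^sub>\<Omega> omega1CK Z"
  shows "\<exists>W. W \<le>\<^sub>T Z \<and> codes_ordinal W \<alpha>"
proof (rule ccontr)
  let ?B = "{\<alpha> \<in> Field omega1. \<not> (\<exists>W. W \<le>\<^sub>T Z \<and> codes_ordinal W \<alpha>)}"
  assume "\<not> ?thesis"
  then have "\<alpha> \<in> ?B" using less_omega1_Field[OF assms] by blast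
  then have "(omega1CK Z, \<alpha>) \<in> omega1"
    unfolding omega1CK_def using Well_order_omega1
    by (intro wo_rel.minim_least) (auto simp: wo_rel_def)
  then have "\<alpha> <\<^sub>\<Omega> \<alpha>"
    using assms less_omega1_trans[of \<alpha> "omega1CK Z" \<alpha>] unfolding less_omega1_iff by blast
  then show False using less_omega1_irrefl by blast
qed

section \<open>The game\<close>

text \<open>One definition serves both players: \<open>P\<close> marks the positions at which the
  strategy \<open>s\<close> moves, and \<open>a\<close> lists the opponent's moves by rounds, hence
  \<open>n div 2\<close>.\<close>

fun play :: "(nat \<Rightarrow> bool) \<Rightarrow> (nat list \<Rightarrow> nat) \<Rightarrow> (nat \<Rightarrow> nat) \<Rightarrow> baire" where
  "play P s a n = (if P n then s (map (play P s a) [0..<n]) else a (n div 2))"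

declare play.simps [simp del]

text \<open>A strategy sees only past moves. For player I this gives continuity of the response; for
  player II it allows recording each reply at a finite code.\<close>

lemma play_cong:
  assumes "\<forall>i<k. a i = b i" "n < 2 * k"
  shows "play P s a n = play P s b n"
  using assms(2)
proof (induction n rule: less_induct)
  case (less n)
  have "map (play P s a) [0..<n] = map (play P s b) [0..<n]"
    using less by (intro map_cong) auto
  moreover have "a (n div 2) = b (n div 2)" using assms(1) less.prems by simp
  ultimately show ?case by (simp only: play.simps[of P s _ n])
qed

text \<open>Every natural number decodes to bits: parity for \<open>Z\<close>, comparison with 2 for
  \<open>W\<close>, positivity for \<open>y\<close>. So no move is illegal.\<close>

definition payoff :: "cantor set \<Rightarrow> cantor rel \<Rightarrow> (cantor \<Rightarrow> cantor) \<Rightarrow> baire set" where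
  "payoff K E g = {x. (\<lambda>n. 0 < odds x n) \<le>\<^sub>T (\<lambda>n. odd (evens x n)) \<and>
     (\<exists>V. V \<in> K \<and> strict_map (coded_rel (\<lambda>n. 2 \<le> evens x n)) (coded_rel (g V)) \<and>
       strict_map (coded_rel (g V)) (coded_rel (\<lambda>n. 2 \<le> evens x n)) \<and>
       (\<forall>U. \<not> ((V, U) \<in> E \<and> U \<le>\<^sub>T (\<lambda>n. odd (evens x n)))))}"

lemma loc_const_atoms [simp]:
  "loc_const (\<lambda>x. 0 < x k)" "loc_const (\<lambda>x. odd (x k))" "loc_const (\<lambda>x. 2 \<le> x k)"
  by (rule loc_const_map[OF loc_const_coord])+

text \<open>As \<open>g\<close> is projective but perhaps not continuous, \<open>g V\<close> becomes
  a quantified real constrained to equal it. Quantifiers over Cantor space turn into quantifiers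
  over Baire space via the surjection \<open>c\<close>.\<close>

lemma projective_payoff:
  assumes K: "projective K" and E: "projective E" and g: "projective_fun g"
  shows "projective (payoff K E g)"
proof -
  define c :: "baire \<Rightarrow> cantor" where "c = (\<lambda>x n. 0 < x n)"
  have c: "c (\<lambda>n. of_bool (V n)) = V" for V by (auto simp: c_def fun_eq_iff)
  have g': "projective {x. q x = g (p x)}"
    if "\<And>i. loc_const (\<lambda>x. p x i)" "\<And>i. loc_const (\<lambda>x. q x i)" for p q :: "baire \<Rightarrow> cantor"
    using projective_mem2[OF g[unfolded projective_fun_def] that] by simp
  have "projective {x. c (odds x) \<le>\<^sub>T (\<lambda>n. odd (evens x n)) \<and>
     (\<exists>v. c v \<in> K \<and>
       (\<exists>w. c w = g (c v) \<and> strict_map (coded_rel (\<lambda>n. 2 \<le> evens x n)) (coded_rel (c w)) \<and>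
         strict_map (coded_rel (c w)) (coded_rel (\<lambda>n. 2 \<le> evens x n))) \<and>
       (\<forall>u. \<not> ((c v, c u) \<in> E \<and> c u \<le>\<^sub>T (\<lambda>n. odd (evens x n)))))}"
    by (intro projective_conj projective_ex projective_all projective_Not
        projective_mem[OF K] projective_mem2[OF E] projective_turing_le projective_strict_map g')
      (simp_all add: c_def odds_def evens_def)
  moreover have "payoff K E g = {x. c (odds x) \<le>\<^sub>T (\<lambda>n. odd (evens x n)) \<and>
     (\<exists>v. c v \<in> K \<and>
       (\<exists>w. c w = g (c v) \<and> strict_map (coded_rel (\<lambda>n. 2 \<le> evens x n)) (coded_rel (c w)) \<and>
         strict_map (coded_rel (c w)) (coded_rel (\<lambda>n. 2 \<le> evens x n))) \<and>
       (\<forall>u. \<not> ((c v, c u) \<in> E \<and> c u \<le>\<^sub>T (\<lambda>n. odd (evens x n)))))}"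
  proof -
    have ex: "(\<exists>V. Q V) \<longleftrightarrow> (\<exists>v. Q (c v))" and all: "(\<forall>V. Q V) \<longleftrightarrow> (\<forall>v. Q (c v))" for Q
      using c by metis+
    have g_ex: "(\<exists>w. c w = g (c v) \<and> Q (c w)) \<longleftrightarrow> Q (g (c v))" for v Q
      using c by metis
    have "c (odds x) = (\<lambda>n. 0 < odds x n)" for x by (simp add: c_def)
    then show ?thesis
      unfolding payoff_def
      by (subst ex, subst all)
        (simp only: conj_assoc g_ex[where Q = "\<lambda>W. strict_map _ (coded_rel W) \<and> strict_map (coded_rel W) _"])
  qed
  ultimately show ?thesis by simp
qed

section \<open>Player I has no winning strategy\<close>

lemma two_power_odd_inject:
  "2 ^ i * (2 * n + 1) = 2 ^ j * (2 * m + 1) \<Longrightarrow> i = j \<and> n = m" for i j n m :: nat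
proof (induction i arbitrary: j)
  case 0
  show ?case
  proof (cases j)
    case (Suc k)
    have "even (2 ^ j * (2 * m + 1))" using Suc by simp
    then show ?thesis using 0 by (metis even_add even_mult_iff mult_1 odd_one power_0 dvd_triv_left)
  qed (use 0 in simp)
next
  case (Suc i)
  show ?case
  proof (cases j)
    case 0
    have "even (2 ^ Suc i * (2 * n + 1))" by simp
    then show ?thesis using 0 Suc.prems by (metis even_add even_mult_iff mult_1 odd_one power_0 dvd_triv_left)
  next
    case (Suc k)
    then have "2 ^ i * (2 * n + 1) = 2 ^ k * (2 * m + 1)" using Suc.prems by simp
    then show ?thesis using Suc.IH Suc by blast
  qed
qed

text \<open>\<open>U i\<close> is stored at the numbers with exactly \<open>i\<close> factors 2,
  which form the progression \<open>2 ^ Suc i * n + 2 ^ i\<close>.\<close>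

lemma countable_upper_bound_turing:
  fixes U :: "nat \<Rightarrow> cantor"
  shows "\<exists>Y. \<forall>Z. Y \<le>\<^sub>T Z \<longrightarrow> (\<forall>i. U i \<le>\<^sub>T Z)"
proof (intro exI allI impI)
  fix Z i
  assume le: "(\<lambda>k. \<exists>i n. k = 2 ^ i * (2 * n + 1) \<and> U i n) \<le>\<^sub>T Z"
  have eq: "2 ^ Suc i * n + 2 ^ i = 2 ^ i * (2 * n + 1)" for n :: nat
    by (simp add: algebra_simps)
  have "U i n \<longleftrightarrow> (\<exists>j m. 2 ^ Suc i * n + 2 ^ i = 2 ^ j * (2 * m + 1) \<and> U j m)" for n
    unfolding eq using two_power_odd_inject by blast
  then show "U i \<le>\<^sub>T Z" by (rule turing_le_linear[OF le])
qed

lemma not_winning_I_payoff: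
  assumes E: "equiv K E" and g: "\<And>X. X \<in> K \<Longrightarrow> codes_ordinal (g X) (r (E `` {X}))"
    and sc: "scattered K E r"
  shows "\<not> winning_I (payoff K E g) \<sigma>"
proof
  assume "winning_I (payoff K E g) \<sigma>"
  moreover have "play even \<sigma> y n = \<sigma> (map (play even \<sigma> y) [0..<n])" if "even n" for y n
    using that by (simp add: play.simps[of _ _ _ n])
  ultimately have win: "play even \<sigma> y \<in> payoff K E g" for y
    unfolding winning_I_def by blast
  \<comment> \<open>The code that player I plays against \<open>y\<close>. It is continuous in
    \<open>y\<close>, and removing \<open>Id\<close> leaves the strict part, to which boundedness
    applies.\<close>
  define W where "W = (\<lambda>y n. 2 \<le> evens (play even \<sigma> y) n)"
  have "loc_const (\<lambda>y. play even \<sigma> y n)" for n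
    unfolding loc_const_def
  proof
    fix y
    have "play even \<sigma> y' n = play even \<sigma> y n" if "\<forall>i<Suc n. y' i = y i" for y'
      by (rule play_cong[OF that]) simp
    then show "\<exists>N. \<forall>y'. (\<forall>i<N. y' i = y i) \<longrightarrow> play even \<sigma> y' n = play even \<sigma> y n" by blast
  qed
  then have "loc_const (\<lambda>y. 2 \<le> play even \<sigma> y k \<and> m \<noteq> n)" for k and m n :: nat
    by (rule loc_const_map[where F = "\<lambda>a. 2 \<le> a \<and> m \<noteq> n"])
  then have loc: "loc_const (\<lambda>y. (m, n) \<in> coded_rel (W y) - Id)" for m n
    by (simp add: W_def coded_rel_def evens_def)
  have wf: "wf (coded_rel (W y) - Id)" for y
    using win[of y] g wf_if_strict_map unfolding payoff_def W_def by blast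
  obtain \<beta> where \<beta>: "\<beta> \<in> Field omega1" and
    bound: "\<And>y. \<exists>h. (\<forall>n. h n <\<^sub>\<Omega> \<beta>) \<and> (\<forall>m n. (m, n) \<in> coded_rel (W y) - Id \<longrightarrow> h m <\<^sub>\<Omega> h n)"
    using continuous_family_bounded[OF loc wf] by blast
  define CC where "CC = {C \<in> K // E. r C = \<beta> \<or> r C <\<^sub>\<Omega> \<beta>}"
  have "countable (\<Union>\<alpha>\<in>insert \<beta> (underS omega1 \<beta>). {C \<in> K // E. r C = \<alpha>})"
    using sc \<beta> countable_underS_omega1 less_omega1_Field
    unfolding scattered_def less_omega1_def by (intro countable_UN) auto
  moreover have "CC \<subseteq> (\<Union>\<alpha>\<in>insert \<beta> (underS omega1 \<beta>). {C \<in> K // E. r C = \<alpha>})"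
    unfolding CC_def less_omega1_def by blast
  ultimately have "countable CC" by (rule countable_subset[rotated])
  \<comment> \<open>A representative of each class in \<open>CC\<close>, enumerated possibly with
    repetitions.\<close>
  define U where "U = (\<lambda>i. SOME X. X \<in> from_nat_into CC i)"
  obtain Y where Y: "\<And>Z i. Y \<le>\<^sub>T Z \<Longrightarrow> U i \<le>\<^sub>T Z"
    using countable_upper_bound_turing by blast
  define y :: baire where "y = (\<lambda>n. of_bool (Y n))"
  define x where "x = play even \<sigma> y"
  define Z where "Z = (\<lambda>n. odd (evens x n))"
  \<comment> \<open>Player II's moves decode to \<open>Y\<close>, so by the first clause of the
    payoff player I's real \<open>Z\<close> computes \<open>Y\<close> and with it every
    \<open>U i\<close>.\<close>
  have "(\<lambda>n. 0 < odds x n) = Y"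
    by (simp add: fun_eq_iff x_def odds_def play.simps[of _ _ _ "Suc _"] y_def)
  then obtain V where YZ: "Y \<le>\<^sub>T Z" and V: "V \<in> K" "strict_map (coded_rel (g V)) (coded_rel (W y))"
    and no: "\<And>U. (V, U) \<in> E \<Longrightarrow> \<not> U \<le>\<^sub>T Z"
    using win[of y] unfolding payoff_def W_def x_def[symmetric] Z_def by auto
  obtain h where h: "\<And>n. h n <\<^sub>\<Omega> \<beta>" "\<And>m n. (m, n) \<in> coded_rel (W y) - Id \<Longrightarrow> h m <\<^sub>\<Omega> h n"
    using bound[of y] by blast
  obtain f where f: "\<And>m n. (m, n) \<in> coded_rel (g V) \<Longrightarrow> m \<noteq> n \<Longrightarrow> (f m, f n) \<in> coded_rel (W y) - Id"
    using V(2) unfolding strict_map_def by blast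
  \<comment> \<open>\<open>h\<close> after \<open>f\<close> ranks \<open>g V\<close> below
    \<open>\<beta>\<close>, so the class of \<open>V\<close> has rank at most \<open>\<beta>\<close>
    and lies in \<open>CC\<close>.\<close>
  have "\<not> \<beta> <\<^sub>\<Omega> r (E `` {V})"
    by (rule codes_ordinal_le[OF g[OF V(1)], of "\<lambda>n. h (f n)"]) (use h f in blast)+
  moreover have "r (E `` {V}) \<in> Field omega1" using g[OF V(1)] unfolding codes_ordinal_def by blast
  ultimately have "E `` {V} \<in> CC"
    unfolding CC_def using less_omega1_linear \<beta> V(1) by (auto intro: quotientI)
  then obtain i where i: "from_nat_into CC i = E `` {V}"
    using from_nat_into_surj[OF \<open>countable CC\<close>] by blast
  have "V \<in> E `` {V}" using equiv_class_self[OF E V(1)] .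
  then have "U i \<in> E `` {V}" unfolding U_def i by (rule someI[of "\<lambda>X. X \<in> E `` {V}"])
  then show False using no[of "U i"] Y[OF YZ, of i] by blast
qed

theorem theorem2p2:
  fixes K :: "cantor set"
    and E :: "cantor rel"
    and r :: "cantor set \<Rightarrow> nat set"
  assumes "projective_determinacy"
    and "ranked_equiv K E r"
    and "projective_ranked K E r"
    and "scattered K E r"
  shows "\<exists>Y. \<forall>Z. Y \<le>\<^sub>T Z \<longrightarrow>
    (\<forall>X \<in> K. r (E `` {X}) <\<^sub>\<Omega> omega1CK Z \<longrightarrow> (\<exists>W \<in> E `` {X}. W \<le>\<^sub>T Z))"
proof -
  obtain g where g: "projective_fun g" "\<And>X. X \<in> K \<Longrightarrow> codes_ordinal (g X) (r (E `` {X}))"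
    and KE: "projective K" "projective E"
    using assms(3) unfolding projective_ranked_def projective_presentation_def by blast
  have "equiv K E" using assms(2) unfolding ranked_equiv_def by blast
  then obtain \<tau> where \<tau>: "winning_II (payoff K E g) \<tau>"
    using assms(1) projective_payoff[OF KE g(1)] not_winning_I_payoff[OF _ g(2) assms(4)]
    unfolding projective_determinacy_def determined_def by blast
  \<comment> \<open>At the code of player I's first \<open>n + 1\<close> moves, \<open>Y\<close>
    stores whether the reply at position \<open>Suc (2 * n)\<close> is positive; these are exactly
    the opponent's moves before that position. Digits below 4 keep the code injective.\<close>
  define Y where "Y = (\<lambda>c. \<exists>a n. (\<forall>i. a i < 4) \<and> c = code4 a (Suc n) \<and> 0 < play odd \<tau> a (Suc (2 * n)))"
  \<comment> \<open>The stored bit does not depend on the sequence chosen to represent the code, by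
    \<open>code4_inject\<close> and \<open>play_cong\<close>.\<close>
  have Y: "Y (code4 a (Suc n)) \<longleftrightarrow> 0 < odds (play odd \<tau> a) n" if "\<And>i. a i < 4" for a n
  proof
    assume "Y (code4 a (Suc n))"
    then obtain b m where b: "\<And>i. b i < 4" "code4 a (Suc n) = code4 b (Suc m)"
      "0 < play odd \<tau> b (Suc (2 * m))" unfolding Y_def by blast
    then have m: "n = m" "\<forall>i<Suc n. a i = b i" using code4_inject[OF b(2) that b(1)] by auto
    then show "0 < odds (play odd \<tau> a) n"
      using b(3) play_cong[OF m(2), of "Suc (2 * n)" odd \<tau>] by (simp add: odds_def)
  next
    assume "0 < odds (play odd \<tau> a) n"
    then show "Y (code4 a (Suc n))" unfolding Y_def odds_def using that by blast
  qed
  show ?thesis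
  proof (intro exI[of _ Y] allI impI ballI, rule ccontr)
    fix Z X
    assume YZ: "Y \<le>\<^sub>T Z" and X: "X \<in> K" and rk: "r (E `` {X}) <\<^sub>\<Omega> omega1CK Z"
      and no: "\<not> (\<exists>W \<in> E `` {X}. W \<le>\<^sub>T Z)"
    obtain W where W: "W \<le>\<^sub>T Z" "codes_ordinal W (r (E `` {X}))"
      using code_below_omega1CK[OF rk] by blast
    define a where "a = (\<lambda>i. of_bool (Z i) + 2 * of_bool (W i) :: nat)"
    define x where "x = play odd \<tau> a"
    have "x n = \<tau> (map x [0..<n])" if "odd n" for n
      using that by (simp add: x_def play.simps[of _ _ _ n])
    then have "x \<notin> payoff K E g" using \<tau> unfolding winning_II_def by blast
    moreover have "x \<in> payoff K E g"
    proof -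
      have ev: "evens x = a" by (simp add: fun_eq_iff evens_def x_def play.simps[of _ _ _ "2 * _"])
      have Z: "(\<lambda>n. odd (evens x n)) = Z" and W': "(\<lambda>n. 2 \<le> evens x n) = W"
        by (auto simp: ev a_def fun_eq_iff)
      have "a i < 4" for i by (simp add: a_def)
      then have "(\<lambda>n. 0 < odds x n) = (\<lambda>n. Y (code4 a (Suc n)))" using Y by (simp add: x_def)
      moreover have "(\<lambda>n. Y (code4 a (Suc n))) \<le>\<^sub>T Z"
        using YZ W(1) Evals_code4[of Z _ Y _ W] unfolding turing_le_def a_def by blast
      \<comment> \<open>\<open>X\<close> itself serves as \<open>V\<close>: \<open>W\<close> and
        \<open>g X\<close> code the same ordinal, and \<open>no\<close> excludes members of the
        class computable from \<open>Z\<close>.\<close>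
      ultimately show ?thesis
        unfolding payoff_def mem_Collect_eq Z W'
        using X no strict_map_if_codes_ordinal[OF W(2) g(2)[OF X]]
          strict_map_if_codes_ordinal[OF g(2)[OF X] W(2)] by auto
    qed
    ultimately show False by blast
  qed
qed

end
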